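(* Let $t$ be a trace and let $P$ be a partial order over a feasible set $X\subseteq\mathcal{E}(t)$ such that $P$ is trace-closed for $t$ and $X$ can be partitioned into two sets $X_1,X_2$ such that (i) $\mathsf{width}(P|X_1)=1$ and (ii) $P|X_2$ is a Mazurkiewicz trace. Then the max-min linearization of $P$ (whichever linearization is chosen in its last step) produces a correct reordering of $t$.
   Context: **Events.** There are finitely many processes, a set of global variables and a set of locks. Each event $e$ belongs to one process $p(e)$, accesses one location $\mathsf{loc}(e)$, and is of exactly one of four types: a write $w(x)$ or read $r(x)$ of a global variable $x$, or an acquire $\mathsf{acq}(\ell)$ or release $\mathsf{rel}(\ell)$ of a lock $\ell$. Two distinct events are *conflicting*, written $e_1\Join e_2$, if they access the same location and either both are read/write events and at least one is a write, or both are lock events (on the same lock). **Event sequences.** Let $t$ be a finite sequence of distinct events. $\mathcal{E}(t)$ is its set of events; $e_1<_t e_2$ means that $e_1$ appears before $e_2$ in $t$; $e_1<_{\mathsf{PO}}e_2$ (program order) means $e_1<_t e_2$ and $p(e_1)=p(e_2)$; $\le_{\mathsf{PO}}$ is its reflexive closure. For a process $q$, $t|q$ is the subsequence of events of $q$. For an acquire event $a$ of $t$, $\mathsf{match}_t(a)$ is the earliest release event $\rho$ of $t$ on the same lock with $a<_t\rho$ ($\bot$ if there is none); if it exists it is required to belong to $p(a)$. For a release event $\rho$, $\mathsf{match}_t(\rho)$ is the acquire event $a$ with $\mathsf{match}_t(a)=\rho$, which is required to exist. **Traces.** $t$ is a *trace* if (1) for every read $r$ of $t$ there is a write $w$ of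 $t$ with $\mathsf{loc}(w)=\mathsf{loc}(r)$ and $w<_t r$; and (2) for any two acquires $a_1<_t a_2$ of $t$ on the same lock, $\mathsf{match}_t(a_1)$ exists in $t$ and $\mathsf{match}_t(a_1)<_t a_2$. The *observation function* $\mathcal{O}_t$ maps each read $r$ of $t$ to the last write to $\mathsf{loc}(r)$ preceding $r$ in $t$. A trace $t'$ is a *correct reordering* of $t$ if $t'|q$ is a prefix of $t|q$ for every process $q$, and $\mathcal{O}_{t'}(r)=\mathcal{O}_t(r)$ for every read $r$ of $t'$. **Feasible sets.** $X\subseteq\mathcal{E}(t)$ is *feasible* for $t$ if: (prefix-closed) $e_1\le_{\mathsf{PO}}e_2\in X$ implies $e_1\in X$; (observation-feasible) $\mathcal{O}_t(r)\in X$ for every read $r\in X$; (lock-feasible) $\mathsf{match}_t(\rho)\in X$ for every release $\rho\in X$, and any two distinct acquires $a_1,a_2\in X$ whose matching releases are not in $X$ access different locks. **Partial orders.** A partial order $P$ over $X$ is a reflexive, antisymmetric, transitive relation $\le_P$ on $X$; $<_P$ is its strict part. $P|Y$ is the restriction to $Y\subseteq X$. $Q\sqsubseteq P$ ($Q$ refines $P$) means that $e_1\le_P e_2$ implies $e_1\le_Q e_2$. A linearization of $P$ is a total order on $X$ refining $P$, viewed as a sequence of events. $\mathsf{width}(P)$ is the largest size of an antichain of $P$. $P$ is a *Mazurkiewicz trace* if any two conflicting events of its domain are ordered by $P$. **Trace-closed partial orders.** $P$ over a feasible set $X$ *respects* $t$ if (1) $P\sqsubseteq\mathsf{PO}|X$;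 (2) $\mathcal{O}_t(r)<_P r$ for every read $r\in X$; (3) for every acquire $a\in X$ with $\mathsf{match}_t(a)\notin X$ (including $\mathsf{match}_t(a)=\bot$) and every release $\rho\in X$ on the same lock, $\rho<_P a$. $P$ is *trace-closed* for $t$ if it respects $t$ and is - *observation-closed*: for every read $r\in X$ with $w=\mathcal{O}_t(r)$ and every write $w'\in X\setminus\{w\}$ with $w'\Join r$: if $w'<_P r$ then $w'<_P w$, and if $w<_P w'$ then $r<_P w'$; and - *lock-closed*: for any two distinct releases $\rho_1,\rho_2\in X$ on the same lock, with $a_i=\mathsf{match}_t(\rho_i)$: if $a_1\le_P\rho_2$ then $\rho_1\le_P a_2$. **Max-min linearization.** Given $t,P,X$ and the partition $X_1,X_2$ as in the claim, let $Q$ be the transitive closure of $P$ together with all pairs $e_1\to e_2$ such that $e_1\in X_1$, $e_2\in X_2$ and $e_1,e_2$ are unordered by $P$. The max-min linearization is any linearization $t^*$ of $Q$. *)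

theory Defs
  imports "HOL-Library.Sublist"
begin

section \<open>Events\<close>

datatype ('x, 'l) action = Write 'x | Read 'x | Acquire 'l | Release 'l

datatype ('x, 'l) location = Var 'x | Lock 'l

text \<open>The identifier keeps apart several events of one process that perform the same action.\<close>

datatype ('i, 'p, 'x, 'l) event = Event (ident: 'i) (proc: 'p) (act: "('x, 'l) action")

fun location_of :: "('x, 'l) action \<Rightarrow> ('x, 'l) location" where
  "location_of (Write x) = Var x"
| "location_of (Read x) = Var x"
| "location_of (Acquire l) = Lock l"
| "location_of (Release l) = Lock l"

definition loc :: "('i, 'p, 'x, 'l) event \<Rightarrow> ('x, 'l) location" where
  "loc e = location_of (act e)"

definition is_write :: "('i, 'p, 'x, 'l) event \<Rightarrow> bool" where
  "is_write e \<longleftrightarrow> (\<exists>x. act e = Write x)"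

definition is_read :: "('i, 'p, 'x, 'l) event \<Rightarrow> bool" where
  "is_read e \<longleftrightarrow> (\<exists>x. act e = Read x)"

definition is_acquire :: "('i, 'p, 'x, 'l) event \<Rightarrow> bool" where
  "is_acquire e \<longleftrightarrow> (\<exists>l. act e = Acquire l)"

definition is_release :: "('i, 'p, 'x, 'l) event \<Rightarrow> bool" where
  "is_release e \<longleftrightarrow> (\<exists>l. act e = Release l)"

definition conflicting :: "('i, 'p, 'x, 'l) event \<Rightarrow> ('i, 'p, 'x, 'l) event \<Rightarrow> bool" where
  "conflicting e1 e2 \<longleftrightarrow> e1 \<noteq> e2 \<and> loc e1 = loc e2 \<and>
     ((is_read e1 \<or> is_write e1) \<and> (is_read e2 \<or> is_write e2) \<and> (is_write e1 \<or> is_write e2) \<or>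
      (is_acquire e1 \<or> is_release e1) \<and> (is_acquire e2 \<or> is_release e2))"

section \<open>Event sequences\<close>

definition before :: "'e list \<Rightarrow> 'e \<Rightarrow> 'e \<Rightarrow> bool" where
  "before t e1 e2 \<longleftrightarrow> (\<exists>i j. i < j \<and> j < length t \<and> t ! i = e1 \<and> t ! j = e2)"

definition po_less :: "('i, 'p, 'x, 'l) event list \<Rightarrow> ('i, 'p, 'x, 'l) event \<Rightarrow> ('i, 'p, 'x, 'l) event \<Rightarrow> bool" where
  "po_less t e1 e2 \<longleftrightarrow> before t e1 e2 \<and> proc e1 = proc e2"

definition po_le :: "('i, 'p, 'x, 'l) event list \<Rightarrow> ('i, 'p, 'x, 'l) event \<Rightarrow> ('i, 'p, 'x, 'l) event \<Rightarrow> bool" where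
  "po_le t e1 e2 \<longleftrightarrow> po_less t e1 e2 \<or> e1 \<in> set t \<and> e1 = e2"

definition proj :: "('i, 'p, 'x, 'l) event list \<Rightarrow> 'p \<Rightarrow> ('i, 'p, 'x, 'l) event list" where
  "proj t q = filter (\<lambda>e. proc e = q) t"

text \<open>Since the events of \<open>t\<close> are distinct, \<open>tl (dropWhile (\<lambda>e. e \<noteq> a) t)\<close> is the part of
  \<open>t\<close> after \<open>a\<close>, and \<open>takeWhile (\<lambda>e. e \<noteq> r) t\<close> the part before \<open>r\<close>. \<open>None\<close> stands for
  a missing match.\<close>

definition match_acq ::
  "('i, 'p, 'x, 'l) event list \<Rightarrow> ('i, 'p, 'x, 'l) event \<Rightarrow> ('i, 'p, 'x, 'l) event option" where
  "match_acq t a = find (\<lambda>rel. is_release rel \<and> loc rel = loc a) (tl (dropWhile (\<lambda>e. e \<noteq> a) t))"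

text \<open>In a trace, every release has exactly one such acquire; elsewhere the value may be
  unspecified.\<close>

definition match_rel ::
  "('i, 'p, 'x, 'l) event list \<Rightarrow> ('i, 'p, 'x, 'l) event \<Rightarrow> ('i, 'p, 'x, 'l) event" where
  "match_rel t rel = (THE a. a \<in> set t \<and> is_acquire a \<and> match_acq t a = Some rel)"

definition event_sequence :: "('i, 'p, 'x, 'l) event list \<Rightarrow> bool" where
  "event_sequence t \<longleftrightarrow> distinct t \<and>
     (\<forall>a\<in>set t. \<forall>rel. is_acquire a \<and> match_acq t a = Some rel \<longrightarrow> proc rel = proc a) \<and>
     (\<forall>rel\<in>set t. is_release rel \<longrightarrow> (\<exists>a\<in>set t. is_acquire a \<and> match_acq t a = Some rel))"

section \<open>Traces and correct reorderings\<close>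

definition is_trace :: "('i, 'p, 'x, 'l) event list \<Rightarrow> bool" where
  "is_trace t \<longleftrightarrow> event_sequence t \<and>
     (\<forall>r\<in>set t. is_read r \<longrightarrow> (\<exists>w\<in>set t. is_write w \<and> loc w = loc r \<and> before t w r)) \<and>
     (\<forall>a1\<in>set t. \<forall>a2\<in>set t. is_acquire a1 \<and> is_acquire a2 \<and> loc a1 = loc a2 \<and> before t a1 a2 \<longrightarrow>
        (\<exists>rel. match_acq t a1 = Some rel \<and> before t rel a2))"

definition observation ::
  "('i, 'p, 'x, 'l) event list \<Rightarrow> ('i, 'p, 'x, 'l) event \<Rightarrow> ('i, 'p, 'x, 'l) event" where
  "observation t r = last (filter (\<lambda>w. is_write w \<and> loc w = loc r) (takeWhile (\<lambda>e. e \<noteq> r) t))"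

definition correct_reordering ::
  "('i, 'p, 'x, 'l) event list \<Rightarrow> ('i, 'p, 'x, 'l) event list \<Rightarrow> bool" where
  "correct_reordering t t' \<longleftrightarrow> is_trace t' \<and>
     (\<forall>q. prefix (proj t' q) (proj t q)) \<and>
     (\<forall>r\<in>set t'. is_read r \<longrightarrow> observation t' r = observation t r)"

section \<open>Feasible sets\<close>

definition open_acquire ::
  "('i, 'p, 'x, 'l) event list \<Rightarrow> ('i, 'p, 'x, 'l) event set \<Rightarrow> ('i, 'p, 'x, 'l) event \<Rightarrow> bool" where
  "open_acquire t X a \<longleftrightarrow> a \<in> X \<and> is_acquire a \<and> \<not> (\<exists>rel\<in>X. match_acq t a = Some rel)"

definition prefix_closed :: "('i, 'p, 'x, 'l) event list \<Rightarrow> ('i, 'p, 'x, 'l) event set \<Rightarrow> bool" where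
  "prefix_closed t X \<longleftrightarrow> (\<forall>e1 e2. po_le t e1 e2 \<and> e2 \<in> X \<longrightarrow> e1 \<in> X)"

definition observation_feasible :: "('i, 'p, 'x, 'l) event list \<Rightarrow> ('i, 'p, 'x, 'l) event set \<Rightarrow> bool" where
  "observation_feasible t X \<longleftrightarrow> (\<forall>r\<in>X. is_read r \<longrightarrow> observation t r \<in> X)"

definition lock_feasible :: "('i, 'p, 'x, 'l) event list \<Rightarrow> ('i, 'p, 'x, 'l) event set \<Rightarrow> bool" where
  "lock_feasible t X \<longleftrightarrow>
     (\<forall>rel\<in>X. is_release rel \<longrightarrow> match_rel t rel \<in> X) \<and>
     (\<forall>a1 a2. open_acquire t X a1 \<and> open_acquire t X a2 \<and> a1 \<noteq> a2 \<longrightarrow> loc a1 \<noteq> loc a2)"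

definition feasible :: "('i, 'p, 'x, 'l) event list \<Rightarrow> ('i, 'p, 'x, 'l) event set \<Rightarrow> bool" where
  "feasible t X \<longleftrightarrow>
     X \<subseteq> set t \<and> prefix_closed t X \<and> observation_feasible t X \<and> lock_feasible t X"

section \<open>Partial orders\<close>

text \<open>A partial order \<open>P\<close> over \<open>X\<close> is a set of pairs with \<^term>\<open>partial_order_on X P\<close>; its
  domain is then \<^term>\<open>Field P\<close>.\<close>

definition strict_less :: "'e rel \<Rightarrow> 'e \<Rightarrow> 'e \<Rightarrow> bool" where
  "strict_less P e1 e2 \<longleftrightarrow> (e1, e2) \<in> P \<and> e1 \<noteq> e2"

definition unordered :: "'e rel \<Rightarrow> 'e \<Rightarrow> 'e \<Rightarrow> bool" where
  "unordered P e1 e2 \<longleftrightarrow> (e1, e2) \<notin> P \<and> (e2, e1) \<notin> P"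

definition refines :: "'e rel \<Rightarrow> 'e rel \<Rightarrow> bool" where
  "refines Q P \<longleftrightarrow> P \<subseteq> Q"

definition antichain :: "'e rel \<Rightarrow> 'e set \<Rightarrow> bool" where
  "antichain P Y \<longleftrightarrow> Y \<subseteq> Field P \<and> (\<forall>e1\<in>Y. \<forall>e2\<in>Y. e1 \<noteq> e2 \<longrightarrow> unordered P e1 e2)"

definition width :: "'e rel \<Rightarrow> nat" where
  "width P = Max (card ` {Y. antichain P Y})"

definition mazurkiewicz_trace :: "('i, 'p, 'x, 'l) event rel \<Rightarrow> bool" where
  "mazurkiewicz_trace P \<longleftrightarrow>
     (\<forall>e1\<in>Field P. \<forall>e2\<in>Field P. conflicting e1 e2 \<longrightarrow> (e1, e2) \<in> P \<or> (e2, e1) \<in> P)"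

definition PO :: "('i, 'p, 'x, 'l) event list \<Rightarrow> ('i, 'p, 'x, 'l) event rel" where
  "PO t = {(e1, e2). po_le t e1 e2}"

definition seq_order :: "'e list \<Rightarrow> 'e rel" where
  "seq_order s = {(e1, e2). before s e1 e2 \<or> e1 \<in> set s \<and> e1 = e2}"

definition linearization :: "'e set \<Rightarrow> 'e rel \<Rightarrow> 'e list \<Rightarrow> bool" where
  "linearization X P s \<longleftrightarrow> distinct s \<and> set s = X \<and> refines (seq_order s) P"

section \<open>Trace-closed partial orders\<close>

definition respects_trace ::
  "('i, 'p, 'x, 'l) event list \<Rightarrow> ('i, 'p, 'x, 'l) event set \<Rightarrow> ('i, 'p, 'x, 'l) event rel \<Rightarrow> bool" where
  "respects_trace t X P \<longleftrightarrow>
     refines P (Restr (PO t) X) \<and>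
     (\<forall>r\<in>X. is_read r \<longrightarrow> strict_less P (observation t r) r) \<and>
     (\<forall>a rel. open_acquire t X a \<and> rel \<in> X \<and> is_release rel \<and> loc rel = loc a \<longrightarrow>
        strict_less P rel a)"

definition observation_closed ::
  "('i, 'p, 'x, 'l) event list \<Rightarrow> ('i, 'p, 'x, 'l) event set \<Rightarrow> ('i, 'p, 'x, 'l) event rel \<Rightarrow> bool" where
  "observation_closed t X P \<longleftrightarrow>
     (\<forall>r\<in>X. is_read r \<longrightarrow>
        (\<forall>w'\<in>X - {observation t r}. is_write w' \<and> conflicting w' r \<longrightarrow>
           (strict_less P w' r \<longrightarrow> strict_less P w' (observation t r)) \<and>
           (strict_less P (observation t r) w' \<longrightarrow> strict_less P r w')))"

definition lock_closed ::
  "('i, 'p, 'x, 'l) event list \<Rightarrow> ('i, 'p, 'x, 'l) event set \<Rightarrow> ('i, 'p, 'x, 'l) event rel \<Rightarrow> bool" where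
  "lock_closed t X P \<longleftrightarrow>
     (\<forall>rel1\<in>X. \<forall>rel2\<in>X. is_release rel1 \<and> is_release rel2 \<and> rel1 \<noteq> rel2 \<and> loc rel1 = loc rel2 \<longrightarrow>
        (match_rel t rel1, rel2) \<in> P \<longrightarrow> (rel1, match_rel t rel2) \<in> P)"

definition trace_closed ::
  "('i, 'p, 'x, 'l) event list \<Rightarrow> ('i, 'p, 'x, 'l) event set \<Rightarrow> ('i, 'p, 'x, 'l) event rel \<Rightarrow> bool" where
  "trace_closed t X P \<longleftrightarrow> respects_trace t X P \<and> observation_closed t X P \<and> lock_closed t X P"

section \<open>Max-min linearization\<close>

definition max_min_order :: "'e rel \<Rightarrow> 'e set \<Rightarrow> 'e set \<Rightarrow> 'e rel" where
  "max_min_order P X1 X2 = (P \<union> {(e1, e2). e1 \<in> X1 \<and> e2 \<in> X2 \<and> unordered P e1 e2})\<^sup>+"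

definition max_min_linearization :: "'e rel \<Rightarrow> 'e set \<Rightarrow> 'e set \<Rightarrow> 'e list \<Rightarrow> bool" where
  "max_min_linearization P X1 X2 s \<longleftrightarrow> linearization (X1 \<union> X2) (max_min_order P X1 X2) s"

end

theory Submission
  imports Defs
begin

text \<open>Call \<open>N\<close> the set of pairs that the max-min order adds to \<open>P\<close>. As \<open>X1\<close> is a chain, a path
  that uses two steps of \<open>N\<close> can be shortened to one that uses only the second, so the order is
  \<open>P \<union> P O N O P\<close>, and a cycle would make a pair of \<open>N\<close> ordered by \<open>P\<close>. In a linearization,
  consider two sets of events that are pairwise conflicting and unordered by \<open>P\<close> across the sets.
  As neither \<open>X1\<close> nor \<open>X2\<close> contains a conflicting pair unordered by \<open>P\<close>, one set lies in \<open>X1\<close>, the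
  other in \<open>X2\<close>, and the first precedes the second as a block. Applied to a write and its reader
  against a third write, and to two critical sections of one lock, this says that the closure rules
  for pairs ordered by \<open>P\<close> are enough.\<close>

section \<open>Precedence in a sequence\<close>

lemma before_Nil [simp]: "\<not> before [] a b"
  by (simp add: before_def)

text \<open>Replaces the indices in \<open>before\<close> by a recursion on the list, so that later
  facts about precedence follow by list induction.\<close>

lemma before_Cons [simp]: "before (x # xs) a b \<longleftrightarrow> a = x \<and> b \<in> set xs \<or> before xs a b"
proof
  assume "before (x # xs) a b"
  then obtain i j where ij: "i < j" "j < length (x # xs)" "(x # xs) ! i = a" "(x # xs) ! j = b"
    unfolding before_def by blast
  then obtain j' where "j = Suc j'"
    by (cases j) auto
  with ij show "a = x \<and> b \<in> set xs \<or> before xs a b"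
    by (cases i) (auto simp: before_def)
next
  assume "a = x \<and> b \<in> set xs \<or> before xs a b"
  then show "before (x # xs) a b"
  proof
    assume "a = x \<and> b \<in> set xs"
    then obtain j where "j < length xs" "xs ! j = b" "a = x"
      by (auto simp: in_set_conv_nth)
    then have "0 < Suc j \<and> Suc j < length (x # xs) \<and> (x # xs) ! 0 = a \<and> (x # xs) ! Suc j = b"
      by simp
    then show ?thesis
      unfolding before_def by blast
  next
    assume "before xs a b"
    then obtain i j where "i < j" "j < length xs" "xs ! i = a" "xs ! j = b"
      unfolding before_def by blast
    then have "Suc i < Suc j \<and> Suc j < length (x # xs) \<and> (x # xs) ! (Suc i) = a \<and> (x # xs) ! Suc j = b"
      by simp
    then show ?thesis
      unfolding before_def by blast
  qed
qed

lemma before_set: "before s a b \<Longrightarrow> a \<in> set s \<and> b \<in> set s"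
  by (induction s) auto

lemma before_append:
  "before (us @ vs) a b \<longleftrightarrow> before us a b \<or> before vs a b \<or> a \<in> set us \<and> b \<in> set vs"
  by (induction us) auto

lemma before_filter: "before (filter Q s) a b \<longleftrightarrow> before s a b \<and> Q a \<and> Q b"
  by (induction s) (auto dest: before_set)

lemma before_irrefl: "distinct s \<Longrightarrow> \<not> before s a a"
  by (induction s) (auto dest: before_set)

lemma before_trans: "distinct s \<Longrightarrow> before s a b \<Longrightarrow> before s b c \<Longrightarrow> before s a c"
  by (induction s) (auto dest: before_set)

lemma before_asym: "distinct s \<Longrightarrow> before s a b \<Longrightarrow> \<not> before s b a"
  using before_irrefl before_trans by metis

lemma before_total:
  "a \<in> set s \<Longrightarrow> b \<in> set s \<Longrightarrow> a \<noteq> b \<Longrightarrow> before s a b \<or> before s b a"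
  by (induction s) auto

text \<open>If the head of a nonempty \<open>u\<close> were not the head of \<open>v\<close>, the
  latter would precede it in \<open>v\<close> and hence in \<open>u\<close>, where nothing precedes
  the head. So the heads agree, and the tails satisfy the same hypotheses.\<close>

lemma prefix_if_downward_closed:
  assumes "distinct u" "distinct v" "set u \<subseteq> set v"
    and "\<And>x y. before v x y \<Longrightarrow> y \<in> set u \<Longrightarrow> before u x y"
  shows "prefix u v"
  using assms
proof (induction v arbitrary: u)
  case Nil
  then show ?case by simp
next
  case (Cons x v)
  show ?case
  proof (cases u)
    case Nil
    then show ?thesis by simp
  next
    case (Cons y u')
    have "y = x"
    proof (rule ccontr)
      assume "y \<noteq> x"
      then have "before u x y"
        using Cons.prems(3) Cons.prems(4)[of x y] Cons by auto
      then show False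
        using Cons.prems(1) Cons by (auto dest: before_set)
    qed
    moreover have "prefix u' v"
    proof (rule Cons.IH)
      fix a b
      assume "before v a b" "b \<in> set u'"
      moreover from this have "a \<noteq> x"
        using Cons.prems(2) by (auto dest: before_set)
      ultimately show "before u' a b"
        using Cons.prems(4)[of a b] Cons \<open>y = x\<close> by auto
    qed (use Cons.prems Cons \<open>y = x\<close> in auto)
    ultimately show ?thesis
      using Cons by simp
  qed
qed

section \<open>Results of list searches in terms of precedence\<close>

lemma last_filter_eqI:
  assumes "w \<in> set xs" "Q w" and "\<And>y. before xs w y \<Longrightarrow> \<not> Q y"
  shows "last (filter Q xs) = w"
proof -
  obtain us vs where xs: "xs = us @ w # vs"
    using assms(1) by (meson split_list)
  have "filter Q vs = []"
    using assms(3) by (auto simp: xs before_append filter_empty_conv)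
  then show ?thesis
    using assms(2) by (simp add: xs)
qed

lemma find_eq_Some_iff:
  assumes "distinct vs"
  shows "find Q vs = Some x \<longleftrightarrow> x \<in> set vs \<and> Q x \<and> (\<forall>y. before vs y x \<longrightarrow> \<not> Q y)"
  using assms by (induction vs) (auto dest: before_set)

section \<open>Observations and matches\<close>

lemma takeWhile_neq_split: "r \<notin> set xs \<Longrightarrow> takeWhile (\<lambda>e. e \<noteq> r) (xs @ r # ys) = xs"
  by (induction xs) auto

lemma dropWhile_neq_split: "r \<notin> set xs \<Longrightarrow> dropWhile (\<lambda>e. e \<noteq> r) (xs @ r # ys) = r # ys"
  by (induction xs) auto

text \<open>The write \<open>w\<close> makes the filtered list nonempty, so that \<open>last\<close>
  returns one of its elements and not an unspecified value.\<close>

lemma observation_write_before: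
  assumes "distinct s" "r \<in> set s" "is_write w" "loc w = loc r" "before s w r"
  shows "is_write (observation s r)" "loc (observation s r) = loc r" "before s (observation s r) r"
proof -
  obtain us vs where s: "s = us @ r # vs"
    using assms(2) by (meson split_list)
  then have r: "r \<notin> set us" "r \<notin> set vs"
    using assms(1) by auto
  let ?F = "filter (\<lambda>w. is_write w \<and> loc w = loc r) us"
  have obs: "observation s r = last ?F"
    using r by (simp add: observation_def s takeWhile_neq_split)
  have "w \<in> set us"
    using assms(5) r by (auto simp: s before_append dest: before_set)
  then have "?F \<noteq> []"
    using assms(3,4) by (auto simp: filter_empty_conv)
  then have "last ?F \<in> set ?F"
    by (rule last_in_set)
  then show "is_write (observation s r)" "loc (observation s r) = loc r"
    "before s (observation s r) r"
    unfolding obs by (auto simp: s before_append)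
qed

lemma observation_eqI:
  assumes "distinct s" "is_write w" "loc w = loc r" "before s w r"
    and "\<And>w'. is_write w' \<Longrightarrow> loc w' = loc r \<Longrightarrow> before s w w' \<Longrightarrow> \<not> before s w' r"
  shows "observation s r = w"
proof -
  obtain us vs where s: "s = us @ r # vs"
    using before_set[OF assms(4)] by (meson split_list)
  then have r: "r \<notin> set us" "r \<notin> set vs"
    using assms(1) by auto
  have "w \<in> set us"
    using assms(4) r by (auto simp: s before_append dest: before_set)
  then have "last (filter (\<lambda>w. is_write w \<and> loc w = loc r) us) = w"
  proof (rule last_filter_eqI)
    fix y
    assume "before us w y"
    then have "before s w y" "before s y r"
      by (auto simp: s before_append dest: before_set)
    then show "\<not> (is_write y \<and> loc y = loc r)"
      using assms(5) by blast
  qed (use assms in simp)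
  then show ?thesis
    using r by (simp add: observation_def s takeWhile_neq_split)
qed

text \<open>Splitting \<open>s\<close> at \<open>a\<close> turns "after \<open>a\<close>" into
  membership in the tail that \<open>find\<close> searches. In this form, matches in two different
  sequences can be compared through precedence alone.\<close>

lemma match_acq_eq_Some_iff:
  assumes "distinct s" "a \<in> set s"
  shows "match_acq s a = Some rel \<longleftrightarrow>
    before s a rel \<and> is_release rel \<and> loc rel = loc a \<and>
    (\<forall>rel'. is_release rel' \<and> loc rel' = loc a \<and> before s a rel' \<longrightarrow> \<not> before s rel' rel)"
proof -
  obtain us vs where s: "s = us @ a # vs"
    using assms(2) by (meson split_list)
  then have d: "a \<notin> set us" "a \<notin> set vs" "distinct vs" "set us \<inter> set vs = {}"
    using assms(1) by auto
  have after: "before s a y \<longleftrightarrow> y \<in> set vs" for y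
    using d by (auto simp: s before_append dest: before_set)
  have between: "before s a y \<and> before s y x \<longleftrightarrow> before vs y x" if "x \<in> set vs" for x y
    using d that by (auto simp: s before_append dest: before_set)
  have "match_acq s a = find (\<lambda>rel. is_release rel \<and> loc rel = loc a) vs"
    using d by (simp add: match_acq_def s dropWhile_neq_split)
  then have "match_acq s a = Some rel \<longleftrightarrow> rel \<in> set vs \<and> (is_release rel \<and> loc rel = loc a) \<and>
      (\<forall>y. before vs y rel \<longrightarrow> \<not> (is_release y \<and> loc y = loc a))"
    by (simp only: find_eq_Some_iff[OF d(3)])
  moreover have "(\<forall>y. before vs y rel \<longrightarrow> \<not> (is_release y \<and> loc y = loc a)) \<longleftrightarrow>
      (\<forall>y. is_release y \<and> loc y = loc a \<and> before s a y \<longrightarrow> \<not> before s y rel)" if "rel \<in> set vs"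
    using between[OF that] by blast
  ultimately show ?thesis
    unfolding after by blast
qed

lemma match_acq_Some:
  assumes "distinct s" "a \<in> set s" "match_acq s a = Some rel"
  shows "before s a rel" "is_release rel" "loc rel = loc a"
  using assms by (auto simp: match_acq_eq_Some_iff)

text \<open>The description in \<open>match_rel\<close> has a unique solution: of two acquires with
  the match \<open>rel\<close>, both on its lock, the earlier would be released before the later one
  by the trace condition, yet \<open>rel\<close> comes after both.\<close>

lemma match_rel_eqI:
  assumes "is_trace t" "a \<in> set t" "is_acquire a" "match_acq t a = Some rel"
  shows "match_rel t rel = a"
  unfolding match_rel_def
proof (rule the_equality)
  have dist: "distinct t"
    using assms(1) by (simp add: is_trace_def event_sequence_def)
  have no: "\<not> before t b c" if "b \<in> set t" "is_acquire b" "match_acq t b = Some rel"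
    "c \<in> set t" "is_acquire c" "match_acq t c = Some rel" for b c
  proof
    assume "before t b c"
    moreover have "loc b = loc c"
      using match_acq_Some[OF dist] that by metis
    ultimately have "before t rel c"
      using assms(1) that unfolding is_trace_def by fastforce
    then show False
      using before_asym[OF dist] match_acq_Some(1)[OF dist that(4,6)] by blast
  qed
  show "a \<in> set t \<and> is_acquire a \<and> match_acq t a = Some rel"
    using assms by simp
  fix b
  assume "b \<in> set t \<and> is_acquire b \<and> match_acq t b = Some rel"
  then show "b = a"
    using no assms before_total by metis
qed

lemma match_rel_props:
  assumes "is_trace t" "rel \<in> set t" "is_release rel"
  shows "match_rel t rel \<in> set t" "is_acquire (match_rel t rel)"
    "match_acq t (match_rel t rel) = Some rel"
proof -
  obtain a where "a \<in> set t" "is_acquire a" "match_acq t a = Some rel"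
    using assms unfolding is_trace_def event_sequence_def by blast
  moreover from this have "match_rel t rel = a"
    by (rule match_rel_eqI[OF assms(1)])
  ultimately show "match_rel t rel \<in> set t" "is_acquire (match_rel t rel)"
    "match_acq t (match_rel t rel) = Some rel"
    by auto
qed

section \<open>Linearizations\<close>

text \<open>Topological sorting: put a minimal element first and linearize the rest by induction on
  the finite set.\<close>

lemma linearization_exists:
  assumes "finite X" "Q \<subseteq> X \<times> X" "trans Q" "antisym Q"
  shows "\<exists>s. linearization X Q s"
  using assms
proof (induction X arbitrary: Q rule: finite_psubset_induct)
  case (psubset X)
  show ?case
  proof (cases "X = {}")
    case True
    then show ?thesis
      using psubset.prems by (intro exI[of _ "[]"]) (auto simp: linearization_def refines_def)
  next
    case False
    \<comment> \<open>Antisymmetry matters here: if \<open>x\<close>, \<open>y\<close>,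
      \<open>z\<close> is a chain of strict steps, then \<open>x = z\<close> would force
      \<open>x = y\<close>.\<close>
    have "trans (Q - Id)"
      using psubset.prems(2,3) by (rule trans_diff_Id)
    then have "acyclic (Q - Id)"
      by (simp add: acyclic_def)
    moreover have "finite (Q - Id)"
      using psubset.hyps psubset.prems(1) by (meson finite_Diff finite_SigmaI finite_subset)
    ultimately have "wf (Q - Id)"
      by (simp add: finite_acyclic_wf)
    then obtain m where m: "m \<in> X" "\<And>y. (y, m) \<in> Q - Id \<Longrightarrow> y \<notin> X"
      using False by (metis all_not_in_conv wfE_min)
    have "\<exists>s. linearization (X - {m}) (Restr Q (X - {m})) s"
    proof (rule psubset.IH)
      show "trans (Restr Q (X - {m}))"
        using psubset.prems(2) by (rule trans_Restr)
      show "antisym (Restr Q (X - {m}))"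
        using psubset.prems(3) by (rule antisym_subset[rotated]) auto
    qed (use m in auto)
    then obtain s where s: "distinct s" "set s = X - {m}" "Restr Q (X - {m}) \<subseteq> seq_order s"
      by (auto simp: linearization_def refines_def)
    have "Q \<subseteq> seq_order (m # s)"
    proof
      fix p
      assume "p \<in> Q"
      moreover obtain a b where p: "p = (a, b)"
        by force
      ultimately have ab: "(a, b) \<in> Q" "a \<in> X" "b \<in> X"
        using psubset.prems(1) by auto
      show "p \<in> seq_order (m # s)"
      proof (cases "a = m \<or> b = m")
        case True
        then show ?thesis
          using ab m s(2) by (auto simp: p seq_order_def)
      next
        case False
        then have "(a, b) \<in> seq_order s"
          using ab s(3) by auto
        then show ?thesis
          by (auto simp: p seq_order_def)
      qed
    qed
    then have "linearization X Q (m # s)"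
      using s m(1) by (auto simp: linearization_def refines_def)
    then show ?thesis ..
  qed
qed

lemma linearization_before:
  assumes "linearization X Q s" "strict_less Q a b"
  shows "before s a b"
  using assms by (auto simp: linearization_def refines_def strict_less_def seq_order_def)

section \<open>Width one and the shape of the max-min order\<close>

lemma width_one_total:
  assumes "finite (Field P)" "width P = 1" "a \<in> Field P" "b \<in> Field P" "a \<noteq> b"
  shows "(a, b) \<in> P \<or> (b, a) \<in> P"
proof (rule ccontr)
  assume "\<not> ((a, b) \<in> P \<or> (b, a) \<in> P)"
  then have "antichain P {a, b}"
    using assms by (auto simp: antichain_def unordered_def)
  \<comment> \<open>\<open>Max\<close> bounds the elements of a set only if the set is
    finite.\<close>
  moreover have "finite {Y. antichain P Y}"
    using assms(1) by (auto simp: antichain_def intro: finite_subset[of _ "Pow (Field P)"])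
  ultimately have "card {a, b} \<le> width P"
    unfolding width_def by (intro Max_ge) auto
  then show False
    using assms by simp
qed

text \<open>A normal form for paths, by induction along the path: a further step in \<open>P\<close>
  is absorbed by transitivity, and a further step in \<open>?N\<close> starts in the chain
  \<open>X1\<close>, which lets all earlier steps collapse into one pair of
  \<open>P\<close>.\<close>

lemma max_min_order_subset:
  assumes "partial_order_on X P" "X1 \<union> X2 = X"
    and chain: "\<And>a b. a \<in> X1 \<Longrightarrow> b \<in> X1 \<Longrightarrow> (a, b) \<in> P \<or> (b, a) \<in> P"
  shows "max_min_order P X1 X2 \<subseteq>
    P \<union> P O {(e1, e2). e1 \<in> X1 \<and> e2 \<in> X2 \<and> unordered P e1 e2} O P"
proof -
  let ?N = "{(e1, e2). e1 \<in> X1 \<and> e2 \<in> X2 \<and> unordered P e1 e2}"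
  have P: "refl_on X P" "trans P"
    using assms(1) by (auto simp: partial_order_on_def preorder_on_def)
  have "(x, y) \<in> P \<union> P O ?N O P" if "(x, y) \<in> (P \<union> ?N)\<^sup>+" for x y
    using that
  proof (induction rule: trancl_induct)
    case (base y)
    then show ?case
      using P(1) assms(2) unfolding refl_on_def by (auto intro!: relcompI)
  next
    case (step y z)
    show ?case
    proof (cases "(y, z) \<in> P")
      case True
      then show ?thesis
        using step.IH P(2) by (blast dest: transD)
    next
      case False
      then have yz: "y \<in> X1" "z \<in> X2" "unordered P y z" "(z, z) \<in> P"
        using step.hyps(2) P(1) assms(2) by (auto simp: refl_on_def)
      have "(x, y) \<in> P"
        using step.IH
      proof
        assume "(x, y) \<in> P O ?N O P"
        then obtain e1 e2 where e: "(x, e1) \<in> P" "e1 \<in> X1" "unordered P e1 e2" "(e2, y) \<in> P"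
          by blast
        \<comment> \<open>Otherwise \<open>e2\<close> would lie below \<open>e1\<close> via
          \<open>y\<close>. Since \<open>e1\<close> and \<open>y\<close> both lie in the chain,
          \<open>e1\<close> is then below \<open>y\<close>, which bypasses the earlier step from
          \<open>e1\<close> to \<open>e2\<close>.\<close>
        have "(y, e1) \<notin> P"
          using e P(2) unfolding unordered_def by (meson transD)
        then have "(e1, y) \<in> P"
          using chain e(2) yz(1) by blast
        then show ?thesis
          using e(1) P(2) by (meson transD)
      qed
      then show ?thesis
        using yz by blast
    qed
  qed
  then show ?thesis
    unfolding max_min_order_def by auto
qed

text \<open>As \<open>P\<close> is antisymmetric, two distinct events ordered both ways would give a
  cycle through some pair \<open>(e1, e2)\<close> of \<open>?N\<close>. The normal form of the way
  back from \<open>e2\<close> to \<open>e1\<close> then leaves two cases to refute.\<close>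

lemma antisym_max_min_order:
  assumes "partial_order_on X P" "X1 \<union> X2 = X"
    and chain: "\<And>a b. a \<in> X1 \<Longrightarrow> b \<in> X1 \<Longrightarrow> (a, b) \<in> P \<or> (b, a) \<in> P"
  shows "antisym (max_min_order P X1 X2)"
proof (rule antisymI)
  let ?N = "{(e1, e2). e1 \<in> X1 \<and> e2 \<in> X2 \<and> unordered P e1 e2}"
  have P: "trans P" "antisym P"
    using assms(1) by (auto simp: partial_order_on_def preorder_on_def)
  have sub: "max_min_order P X1 X2 \<subseteq> P \<union> P O ?N O P"
    using assms by (rule max_min_order_subset)
  fix x y
  assume xy: "(x, y) \<in> max_min_order P X1 X2" "(y, x) \<in> max_min_order P X1 X2"
  have Q_trans: "trans (max_min_order P X1 X2)"
    by (simp add: max_min_order_def)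
  show "x = y"
  proof (cases "(x, y) \<in> P \<and> (y, x) \<in> P")
    case True
    then show ?thesis
      using P(2) by (auto dest: antisymD)
  next
    case False
    have P_N: "\<not> ((u, v) \<in> P O ?N O P \<and> (v, u) \<in> max_min_order P X1 X2)" for u v
    proof
      assume uv: "(u, v) \<in> P O ?N O P \<and> (v, u) \<in> max_min_order P X1 X2"
      then obtain e1 e2 where e: "(u, e1) \<in> P" "(e1, e2) \<in> ?N" "(e2, v) \<in> P"
        by blast
      have "(e2, v) \<in> max_min_order P X1 X2" "(u, e1) \<in> max_min_order P X1 X2"
        using e unfolding max_min_order_def by auto
      then have "(e2, e1) \<in> max_min_order P X1 X2"
        using uv Q_trans by (meson transD)
      then consider "(e2, e1) \<in> P" | "(e2, e1) \<in> P O ?N O P"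
        using sub by blast
      then show False
      proof cases
        case 1
        then show False
          using e(2) by (auto simp: unordered_def)
      next
        case 2
        then obtain f1 f2 where f: "(e2, f1) \<in> P" "(f1, f2) \<in> ?N" "(f2, e1) \<in> P"
          by blast
        \<comment> \<open>If \<open>e1\<close> is below \<open>f1\<close>, then \<open>f2\<close> is
          below \<open>f1\<close>; if \<open>f1\<close> is below \<open>e1\<close>, then
          \<open>e2\<close> is below \<open>e1\<close>. Either way a pair of \<open>?N\<close> is
          ordered by \<open>P\<close>.\<close>
        have "(e1, f1) \<in> P \<or> (f1, e1) \<in> P"
          using chain e(2) f(2) by blast
        then show False
          using e(2) f P(1) unfolding unordered_def by (blast dest: transD)
      qed
    qed
    then show ?thesis
      using False sub xy by blast
  qed
qed

section \<open>Correctness of max-min linearizations\<close>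

locale trace_closed_partition =
  fixes t :: "('i, 'p, 'x, 'l) event list"
    and X X1 X2 :: "('i, 'p, 'x, 'l) event set"
    and P :: "('i, 'p, 'x, 'l) event rel"
  assumes trace: "is_trace t"
    and feasible: "feasible t X"
    and order: "partial_order_on X P"
    and closed: "trace_closed t X P"
    and partition: "X1 \<union> X2 = X"
    and width: "width (Restr P X1) = 1"
    and mazurkiewicz: "mazurkiewicz_trace (Restr P X2)"
begin

section \<open>Order facts on \<open>X\<close> and its two parts\<close>

lemma t_distinct: "distinct t"
  using trace by (simp add: is_trace_def event_sequence_def)

lemma X_subset: "X \<subseteq> set t"
  using feasible by (simp add: feasible_def)

lemma P_subset: "P \<subseteq> X \<times> X"
  using order by (auto simp: partial_order_on_def preorder_on_def)

lemma P_refl: "a \<in> X \<Longrightarrow> (a, a) \<in> P"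
  using order by (auto simp: partial_order_on_def preorder_on_def refl_on_def)

lemma P_trans: "(a, b) \<in> P \<Longrightarrow> (b, c) \<in> P \<Longrightarrow> (a, c) \<in> P"
  using order by (auto simp: partial_order_on_def preorder_on_def dest: transD)

lemma Field_Restr: "Y \<subseteq> X \<Longrightarrow> Field (Restr P Y) = Y"
  using P_refl by (auto simp: Field_def)

lemma X1_chain:
  assumes "a \<in> X1" "b \<in> X1"
  shows "(a, b) \<in> P \<or> (b, a) \<in> P"
proof (cases "a = b")
  case True
  then show ?thesis
    using P_refl assms partition by auto
next
  case False
  have F: "Field (Restr P X1) = X1"
    using Field_Restr partition by auto
  moreover have "finite X1"
    using X_subset partition by (auto intro: finite_subset)
  ultimately show ?thesis
    using width_one_total[of "Restr P X1" a b] width assms False by auto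
qed

lemma X2_conflicting:
  assumes "a \<in> X2" "b \<in> X2" "conflicting a b"
  shows "(a, b) \<in> P \<or> (b, a) \<in> P"
proof -
  have "Field (Restr P X2) = X2"
    using Field_Restr partition by auto
  then show ?thesis
    using mazurkiewicz assms by (auto simp: mazurkiewicz_trace_def)
qed

text \<open>Keeps the claim about every linearization from being vacuous; its substance is the
  antisymmetry of the max-min order.\<close>

lemma max_min_linearization_exists: "\<exists>s. max_min_linearization P X1 X2 s"
  unfolding max_min_linearization_def partition
proof (rule linearization_exists)
  show "finite X"
    using X_subset by (auto intro: finite_subset)
  have "P \<union> {(e1, e2). e1 \<in> X1 \<and> e2 \<in> X2 \<and> unordered P e1 e2} \<subseteq> X \<times> X"
    using P_subset partition by auto
  then show "max_min_order P X1 X2 \<subseteq> X \<times> X"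
    unfolding max_min_order_def by (rule trancl_subset_Sigma)
  show "trans (max_min_order P X1 X2)"
    by (simp add: max_min_order_def)
  show "antisym (max_min_order P X1 X2)"
    using order partition X1_chain by (rule antisym_max_min_order)
qed

section \<open>Program order, observations and matches inside \<open>X\<close>\<close>

lemma PO_less:
  assumes "before t a b" "proc a = proc b" "b \<in> X"
  shows "a \<in> X" "strict_less P a b"
proof -
  have "po_le t a b"
    using assms by (simp add: po_le_def po_less_def)
  then show a: "a \<in> X"
    using feasible assms(3) by (auto simp: feasible_def prefix_closed_def)
  have "(a, b) \<in> Restr (PO t) X"
    using \<open>po_le t a b\<close> a assms(3) by (simp add: PO_def)
  moreover have "a \<noteq> b"
    using assms(1) before_irrefl[OF t_distinct] by blast
  ultimately show "strict_less P a b"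
    using closed by (auto simp: trace_closed_def respects_trace_def refines_def strict_less_def)
qed

lemma observation_X:
  assumes "r \<in> X" "is_read r"
  shows "observation t r \<in> X" "is_write (observation t r)" "loc (observation t r) = loc r"
    "strict_less P (observation t r) r"
proof -
  obtain w where "is_write w" "loc w = loc r" "before t w r"
    using trace assms X_subset unfolding is_trace_def by blast
  then show "is_write (observation t r)" "loc (observation t r) = loc r"
    using observation_write_before[OF t_distinct] assms X_subset by blast+
  show "observation t r \<in> X"
    using feasible assms by (auto simp: feasible_def observation_feasible_def)
  show "strict_less P (observation t r) r"
    using closed assms by (auto simp: trace_closed_def respects_trace_def)
qed

lemma match_acq_X:
  assumes "a \<in> X" "is_acquire a" "match_acq t a = Some rel"
  shows "is_release rel" "loc rel = loc a" "proc rel = proc a" "before t a rel"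
    "match_rel t rel = a"
proof -
  have a: "a \<in> set t"
    using assms(1) X_subset by blast
  show "is_release rel" "loc rel = loc a" "before t a rel"
    using match_acq_Some[OF t_distinct a assms(3)] by simp_all
  show "proc rel = proc a"
    using trace a assms(2,3) by (simp add: is_trace_def event_sequence_def)
  show "match_rel t rel = a"
    using trace a assms(2,3) by (rule match_rel_eqI)
qed

lemma match_acq_less:
  assumes "a \<in> X" "is_acquire a" "match_acq t a = Some rel" "rel \<in> X"
  shows "strict_less P a rel"
  using PO_less(2) match_acq_X[OF assms(1-3)] assms(4) by simp

lemma match_rel_X:
  assumes "rel \<in> X" "is_release rel"
  shows "match_rel t rel \<in> X" "is_acquire (match_rel t rel)"
    "match_acq t (match_rel t rel) = Some rel"
  using match_rel_props[OF trace _ assms(2)] assms X_subset feasible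
  by (auto simp: feasible_def lock_feasible_def)

lemma locked_release_before:
  assumes "rel1 \<in> X" "rel2 \<in> X" "is_release rel1" "is_release rel2" "rel1 \<noteq> rel2"
    "loc rel1 = loc rel2" "(match_rel t rel1, rel2) \<in> P"
  shows "(rel1, match_rel t rel2) \<in> P"
  using closed assms unfolding trace_closed_def lock_closed_def by blast

section \<open>Blocks, observations and matches in a max-min linearization\<close>

context
  fixes s
  assumes s: "max_min_linearization P X1 X2 s"
begin

lemma s_distinct: "distinct s" and s_set: "set s = X"
  using s partition by (auto simp: max_min_linearization_def linearization_def)

lemma P_before: "strict_less P a b \<Longrightarrow> before s a b"
proof -
  assume "strict_less P a b"
  then have "strict_less (max_min_order P X1 X2) a b"
    by (auto simp: strict_less_def max_min_order_def)
  then show ?thesis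
    using s unfolding max_min_linearization_def by (rule linearization_before[rotated])
qed

lemma unordered_before:
  assumes "a \<in> X1" "b \<in> X2" "unordered P a b"
  shows "before s a b"
proof -
  have "a \<noteq> b"
    using assms P_refl partition by (auto simp: unordered_def)
  then have "strict_less (max_min_order P X1 X2) a b"
    using assms by (auto simp: strict_less_def max_min_order_def)
  then show ?thesis
    using s unfolding max_min_linearization_def by (rule linearization_before[rotated])
qed

text \<open>The only place where the two conditions on the parts meet: a conflicting pair unordered
  by \<open>P\<close> cannot lie within the chain \<open>X1\<close>, nor within the Mazurkiewicz
  part \<open>X2\<close>, so it is split between them and \<open>s\<close> puts its
  \<open>X1\<close> member first.\<close>

lemma unordered_blocks:
  assumes "C \<subseteq> X" "D \<subseteq> X"
    and cd: "\<And>c d. c \<in> C \<Longrightarrow> d \<in> D \<Longrightarrow> unordered P c d \<and> conflicting c d"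
  shows "(\<forall>c\<in>C. \<forall>d\<in>D. before s c d) \<or> (\<forall>c\<in>C. \<forall>d\<in>D. before s d c)"
proof -
  have sym: "unordered P d c" if "unordered P c d" for c d
    using that by (auto simp: unordered_def)
  \<comment> \<open>The clauses \<open>d \<notin> X1\<close> and \<open>c \<notin> X1\<close>
    prevent a change of sides: one \<open>c\<close> in \<open>X1\<close> keeps all of
    \<open>D\<close> out of \<open>X1\<close>, which in turn puts all of \<open>C\<close> into
    \<open>X1\<close>.\<close>
  have split: "c \<in> X1 \<and> d \<in> X2 \<and> d \<notin> X1 \<or> c \<in> X2 \<and> c \<notin> X1 \<and> d \<in> X1" if "c \<in> C" "d \<in> D" for c d
    using that cd[OF that] X1_chain[of c d] X2_conflicting[of c d] partition assms(1,2)
    unfolding unordered_def by blast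
  show ?thesis
  proof (cases "\<exists>c\<in>C. c \<in> X1")
    case True
    then have "c \<in> X1 \<and> d \<in> X2" if "c \<in> C" "d \<in> D" for c d
      using split that by blast
    then show ?thesis
      using cd unordered_before by blast
  next
    case False
    then have "c \<in> X2 \<and> d \<in> X1" if "c \<in> C" "d \<in> D" for c d
      using split that by blast
    then show ?thesis
      using cd sym unordered_before by blast
  qed
qed

text \<open>A predecessor in program order of an event of \<open>X\<close> is itself in
  \<open>X\<close> and below that event in \<open>P\<close>, so \<open>s\<close> keeps both the
  predecessor and its position.\<close>

lemma proj_prefix: "prefix (proj s q) (proj t q)"
proof (rule prefix_if_downward_closed)
  fix x y
  assume "before (proj t q) x y" "y \<in> set (proj s q)"
  then show "before (proj s q) x y"
    using PO_less P_before by (auto simp: proj_def before_filter s_set)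
qed (use s_distinct t_distinct s_set X_subset in \<open>auto simp: proj_def\<close>)

text \<open>A write \<open>w'\<close> placed by \<open>s\<close> strictly between \<open>?w\<close>
  and \<open>r\<close> turns out to be unordered by \<open>P\<close> with both. Then
  \<open>{w'}\<close> and \<open>{r, ?w}\<close> form blocks, and \<open>w'\<close> cannot fall
  between the two.\<close>

lemma observation_s:
  assumes r: "r \<in> X" "is_read r"
  shows "observation s r = observation t r"
proof (rule observation_eqI)
  let ?w = "observation t r"
  note w = observation_X[OF r]
  show "before s ?w r"
    using w(4) by (rule P_before)
  fix w'
  assume w': "is_write w'" "loc w' = loc r" and ww': "before s ?w w'"
  show "\<not> before s w' r"
  proof
    assume w'r: "before s w' r"
    have X': "w' \<in> X" "w' \<noteq> ?w" "w' \<noteq> r"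
      using w'r ww' before_set before_irrefl[OF s_distinct] s_set by metis+
    have confl: "conflicting w' r" "conflicting w' ?w"
      using w' w X' r by (auto simp: conflicting_def)
    have outside: "\<not> strict_less P r w'" "\<not> strict_less P w' ?w"
      using P_before before_asym[OF s_distinct] w'r ww' by blast+
    \<comment> \<open>Contrapositive of observation-closure: each of these orderings would imply one
      of the two that the positions in \<open>s\<close> just excluded.\<close>
    then have "\<not> strict_less P w' r" "\<not> strict_less P ?w w'"
      using closed X' confl(1) r w'(1) unfolding trace_closed_def observation_closed_def by blast+
    with outside have "unordered P w' r" "unordered P w' ?w"
      using X' by (auto simp: unordered_def strict_less_def)
    then have "(\<forall>c\<in>{w'}. \<forall>d\<in>{r, ?w}. before s c d) \<or> (\<forall>c\<in>{w'}. \<forall>d\<in>{r, ?w}. before s d c)"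
      using confl X' r w by (intro unordered_blocks) auto
    then show False
      using before_asym[OF s_distinct] w'r ww' by blast
  qed
qed (use s_distinct observation_X[OF r] in auto)

text \<open>If one acquire is below the other release in \<open>P\<close>, lock-closure separates
  the two sections. Otherwise the sections are unordered by \<open>P\<close> throughout and
  \<open>s\<close> separates them as blocks.\<close>

lemma critical_sections_disjoint:
  assumes "a1 \<in> X" "a2 \<in> X" "is_acquire a1" "is_acquire a2" "a1 \<noteq> a2" "loc a1 = loc a2"
    and m1: "match_acq t a1 = Some rel1" "rel1 \<in> X"
    and m2: "match_acq t a2 = Some rel2" "rel2 \<in> X"
  shows "before s rel1 a2 \<or> before s rel2 a1"
proof -
  note r1 = match_acq_X[OF assms(1,3) m1(1)] and r2 = match_acq_X[OF assms(2,4) m2(1)]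
  have ar: "(a1, rel1) \<in> P" "(a2, rel2) \<in> P"
    using match_acq_less assms by (auto simp: strict_less_def)
  have neq: "rel1 \<noteq> rel2" "rel1 \<noteq> a2" "rel2 \<noteq> a1"
    using r1 r2 assms by (auto simp: is_release_def is_acquire_def)
  show ?thesis
  proof (cases "(a1, rel2) \<in> P \<or> (a2, rel1) \<in> P")
    case True
    then have "(rel1, a2) \<in> P \<or> (rel2, a1) \<in> P"
      using locked_release_before[of rel1 rel2] locked_release_before[of rel2 rel1]
        r1 r2 neq assms by auto
    then show ?thesis
      using P_before neq by (auto simp: strict_less_def)
  next
    case False
    have "(\<forall>c\<in>{a1, rel1}. \<forall>d\<in>{a2, rel2}. before s c d) \<or>
      (\<forall>c\<in>{a1, rel1}. \<forall>d\<in>{a2, rel2}. before s d c)"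
    proof (rule unordered_blocks)
      fix c d
      assume cd: "c \<in> {a1, rel1}" "d \<in> {a2, rel2}"
      \<comment> \<open>Each event lies between its acquire and its release, so \<open>c\<close>
        below \<open>d\<close> would put \<open>a1\<close> below \<open>rel2\<close>, and
        \<open>d\<close> below \<open>c\<close> would put \<open>a2\<close> below
        \<open>rel1\<close>.\<close>
      have "(a1, c) \<in> P" "(c, rel1) \<in> P" "(a2, d) \<in> P" "(d, rel2) \<in> P"
        using cd ar P_refl assms by auto
      then have "unordered P c d"
        using False P_trans unfolding unordered_def by blast
      moreover have "conflicting c d"
        using cd r1 r2 assms neq by (auto simp: conflicting_def)
      ultimately show "unordered P c d \<and> conflicting c d" ..
    qed (use assms in auto)
    then show ?thesis
      by blast
  qed
qed

lemma open_acquire_last: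
  assumes "open_acquire t X a" "rel \<in> X" "is_release rel" "loc rel = loc a"
  shows "before s rel a"
  using closed assms P_before unfolding trace_closed_def respects_trace_def by blast

text \<open>A release in \<open>s\<close> between \<open>a\<close> and its match in \<open>t\<close>
  would belong to a critical section overlapping that of \<open>a\<close>. Conversely, a match in
  \<open>s\<close> shows that \<open>a\<close> is not open, since open acquires follow all releases
  of their lock.\<close>

lemma match_acq_s:
  assumes a: "a \<in> X" "is_acquire a"
  shows "match_acq s a = Some rel \<longleftrightarrow> match_acq t a = Some rel \<and> rel \<in> X"
proof -
  have as: "a \<in> set s"
    using a s_set by simp
  have closed_match: "match_acq s a = Some rel" if m: "match_acq t a = Some rel" "rel \<in> X" for rel
  proof -
    note r = match_acq_X[OF a m(1)]
    have "\<not> before s rel' rel"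
      if rel': "is_release rel'" "loc rel' = loc a" "before s a rel'" for rel'
    proof
      assume b: "before s rel' rel"
      then have X': "rel' \<in> X" "rel' \<noteq> rel"
        using before_set before_irrefl[OF s_distinct] s_set by metis+
      let ?a' = "match_rel t rel'"
      note m' = match_rel_X[OF X'(1) rel'(1)]
      have "?a' \<noteq> a" "loc ?a' = loc a"
        using m'(3) m(1) X' rel' match_acq_X(2)[OF m'] by auto
      \<comment> \<open>Disjointness of the section of \<open>a\<close> and that of
        \<open>?a'\<close>. Each alternative contradicts \<open>rel'\<close> lying between
        \<open>a\<close> and \<open>rel\<close>.\<close>
      then consider "before s rel ?a'" | "before s rel' a"
        using critical_sections_disjoint[OF a(1) m'(1) a(2) m'(2) _ _ m m'(3) X'(1)] by metis
      then show False
      proof cases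
        case 1
        moreover have "before s ?a' rel'"
          using match_acq_less m' X' by (intro P_before) blast
        ultimately show False
          using b before_trans[OF s_distinct] before_irrefl[OF s_distinct] by metis
      next
        case 2
        then show False
          using rel' before_asym[OF s_distinct] by blast
      qed
    qed
    moreover have "before s a rel"
      using match_acq_less a m by (intro P_before) blast
    ultimately show ?thesis
      using r unfolding match_acq_eq_Some_iff[OF s_distinct as] by blast
  qed
  show ?thesis
  proof
    assume ms: "match_acq s a = Some rel"
    note rel = match_acq_Some[OF s_distinct as ms]
    then have "rel \<in> X"
      using before_set s_set by metis
    then have "\<not> open_acquire t X a"
      using open_acquire_last rel before_asym[OF s_distinct] by metis
    then obtain rel' where "match_acq t a = Some rel'" "rel' \<in> X"
      using a by (auto simp: open_acquire_def)
    \<comment> \<open>By the direction already proved, \<open>rel'\<close> is also the match of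
      \<open>a\<close> in \<open>s\<close>, hence equal to \<open>rel\<close>.\<close>
    then show "match_acq t a = Some rel \<and> rel \<in> X"
      using closed_match ms by force
  qed (use closed_match in blast)
qed

section \<open>The linearization is a trace and a correct reordering\<close>

lemma event_sequence_s: "event_sequence s"
  unfolding event_sequence_def
proof (intro conjI ballI allI impI)
  fix a rel
  assume "a \<in> set s" "is_acquire a \<and> match_acq s a = Some rel"
  then show "proc rel = proc a"
    using match_acq_s match_acq_X(3) s_set by blast
next
  fix rel
  assume "rel \<in> set s" "is_release rel"
  then show "\<exists>a\<in>set s. is_acquire a \<and> match_acq s a = Some rel"
    using match_rel_X match_acq_s s_set by metis
qed (rule s_distinct)

lemma is_trace_s: "is_trace s"
  unfolding is_trace_def
proof (intro conjI ballI impI)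
  fix r
  assume "r \<in> set s" "is_read r"
  then show "\<exists>w\<in>set s. is_write w \<and> loc w = loc r \<and> before s w r"
    using observation_X P_before s_set by blast
next
  fix a1 a2
  assume X: "a1 \<in> set s" "a2 \<in> set s"
    and a: "is_acquire a1 \<and> is_acquire a2 \<and> loc a1 = loc a2 \<and> before s a1 a2"
  have neq: "a1 \<noteq> a2"
    using a before_irrefl[OF s_distinct] by blast
  \<comment> \<open>If \<open>a1\<close> were open, lock-feasibility would give \<open>a2\<close> a
    release in \<open>X\<close>, and that release would precede \<open>a1\<close>. With
    \<open>a1\<close> before \<open>a2\<close> this closes a cycle in \<open>s\<close>.\<close>
  have closed1: "\<not> open_acquire t X a1"
  proof
    assume o: "open_acquire t X a1"
    then have "\<not> open_acquire t X a2"
      using feasible a neq unfolding feasible_def lock_feasible_def by blast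
    then obtain rel where rel: "match_acq t a2 = Some rel" "rel \<in> X"
      using X a s_set by (auto simp: open_acquire_def)
    have "before s a2 rel"
      using match_acq_less rel X a s_set by (intro P_before) blast
    moreover have "before s rel a1"
      using open_acquire_last[OF o rel(2)] match_acq_X[OF _ _ rel(1)] X a s_set by auto
    ultimately show False
      using a before_trans[OF s_distinct] before_irrefl[OF s_distinct] by metis
  qed
  then obtain rel1 where r1: "match_acq t a1 = Some rel1" "rel1 \<in> X"
    using X a s_set by (auto simp: open_acquire_def)
  \<comment> \<open>An open \<open>a2\<close> follows every release of its lock; otherwise both
    sections are complete in \<open>X\<close>, and \<open>a1\<close> before \<open>a2\<close>
    decides which of the two comes first.\<close>
  have "before s rel1 a2"
  proof (cases "open_acquire t X a2")
    case True
    then show ?thesis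
      using open_acquire_last r1 match_acq_X[OF _ _ r1(1)] X a s_set by auto
  next
    case False
    then obtain rel2 where r2: "match_acq t a2 = Some rel2" "rel2 \<in> X"
      using X a s_set by (auto simp: open_acquire_def)
    have "before s a2 rel2"
      using match_acq_less r2 X a s_set by (intro P_before) blast
    then have "\<not> before s rel2 a1"
      using a before_trans[OF s_distinct] before_irrefl[OF s_distinct] by metis
    then show ?thesis
      using critical_sections_disjoint[OF _ _ _ _ neq _ r1 r2] X a s_set by auto
  qed
  then show "\<exists>rel. match_acq s a1 = Some rel \<and> before s rel a2"
    using match_acq_s r1 X a s_set by auto
qed (rule event_sequence_s)

lemma correct_reordering_s: "correct_reordering t s"
  unfolding correct_reordering_def
  using is_trace_s proj_prefix observation_s s_set by blast

end

end

theorem theorem3p1: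
  fixes t :: "('i, 'p :: finite, 'x, 'l) event list"
    and X X1 X2 :: "('i, 'p, 'x, 'l) event set"
    and P :: "('i, 'p, 'x, 'l) event rel"
  assumes "is_trace t"
    and "feasible t X"
    and "partial_order_on X P"
    and "trace_closed t X P"
    and "X1 \<union> X2 = X" and "X1 \<inter> X2 = {}"
    and "width (Restr P X1) = 1"
    and "mazurkiewicz_trace (Restr P X2)"
  shows "(\<exists>s. max_min_linearization P X1 X2 s) \<and>
         (\<forall>s. max_min_linearization P X1 X2 s \<longrightarrow> correct_reordering t s)"
proof -
  interpret trace_closed_partition t X X1 X2 P
    using assms by unfold_locales
  show ?thesis
    using max_min_linearization_exists correct_reordering_s by blast
qed

end
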